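(* Let $\mathcal{H}$ be a complex Hilbert space, $d\in\mathbb{N}$, and let $\mathbf{T}=(T_1,\ldots,T_d)\in\mathfrak{B}(\mathcal{H})^d$ be a spherically quasinormal $d$-tuple. Then $\mathbf{T}^n$ is spherically quasinormal for all $n\in\mathbb{N}$.
   Context: $\mathfrak{B}(\mathcal{H})$ is the algebra of bounded linear operators on $\mathcal{H}$; $\mathbb{N}=\{1,2,\ldots\}$. An $m$-tuple $\mathbf{A}=(A_1,\ldots,A_m)\in\mathfrak{B}(\mathcal{H})^m$ is spherically quasinormal if each $A_i$, $i\in\{1,\ldots,m\}$, commutes with $\sum_{j=1}^mA_j^*A_j$. For $\mathbf{T}=(T_1,\ldots,T_m)\in\mathfrak{B}(\mathcal{H})^m$ and $\mathbf{S}=(S_1,\ldots,S_n)\in\mathfrak{B}(\mathcal{H})^n$, let $\mathbf{T}\circ\mathbf{S}=(T_1S_1,\ldots,T_1S_n,\ldots,T_mS_1,\ldots,T_mS_n)$, an $mn$-tuple. Powers are defined by $\mathbf{T}^1=\mathbf{T}$ and $\mathbf{T}^{n+1}=\mathbf{T}\circ\mathbf{T}^n$; thus for a $d$-tuple $\mathbf{T}$, $\mathbf{T}^n$ is the $d^n$-tuple of all products $T_{i_1}\cdots T_{i_n}$. *)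

theory Defs
  imports "HOL-Analysis.Analysis"
begin

text \<open>
  A complex inner product space is presented as a real normed vector space with an additional
  complex scalar multiplication extending the real one, and a sesquilinear form (linear in its
  first argument) inducing the norm. Positivity and definiteness of the form follow from
  \<open>cinner_self\<close> and the norm axioms. The zero space is included.
\<close>

class complex_inner = real_normed_vector +
  fixes scaleC :: "complex \<Rightarrow> 'a \<Rightarrow> 'a"  (infixr "*\<^sub>C" 75)
    and cinner :: "'a \<Rightarrow> 'a \<Rightarrow> complex"
  assumes scaleC_add_right: "c *\<^sub>C (x + y) = c *\<^sub>C x + c *\<^sub>C y"
    and scaleC_add_left: "(b + c) *\<^sub>C x = b *\<^sub>C x + c *\<^sub>C x"
    and scaleC_scaleC: "b *\<^sub>C (c *\<^sub>C x) = (b * c) *\<^sub>C x"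
    and scaleR_scaleC: "r *\<^sub>R x = complex_of_real r *\<^sub>C x"
    and cinner_commute: "cinner x y = cnj (cinner y x)"
    and cinner_add_left: "cinner (x + y) z = cinner x z + cinner y z"
    and cinner_scaleC_left: "cinner (c *\<^sub>C x) y = c * cinner x y"
    and cinner_self: "cinner x x = complex_of_real ((norm x)\<^sup>2)"

class chilbert_space = complex_inner + complete_space

subclass (in chilbert_space) banach ..

instantiation complex :: chilbert_space
begin

definition scaleC_complex :: "complex \<Rightarrow> complex \<Rightarrow> complex"
  where "scaleC_complex = (*)"

definition cinner_complex :: "complex \<Rightarrow> complex \<Rightarrow> complex"
  where "cinner_complex x y = x * cnj y"

instance
proof
  show "cinner x x = complex_of_real ((norm x)\<^sup>2)" for x :: complex
    unfolding cinner_complex_def by (rule complex_norm_square[symmetric])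
qed (auto simp: scaleC_complex_def cinner_complex_def algebra_simps scaleR_conv_of_real)

end

lemma cinner_add_right: "cinner z (x + y) = cinner z x + cinner z (y :: 'a :: complex_inner)"
  by (metis cinner_add_left cinner_commute complex_cnj_add)

lemma cinner_scaleC_right: "cinner x (c *\<^sub>C y) = cnj c * cinner x (y :: 'a :: complex_inner)"
  by (metis cinner_scaleC_left cinner_commute complex_cnj_mult)

lemma scaleC_one: "1 *\<^sub>C x = (x :: 'a :: complex_inner)"
  using scaleR_scaleC[of 1 x] by simp

lemma scaleC_zero_left: "0 *\<^sub>C x = (0 :: 'a :: complex_inner)"
  using scaleR_scaleC[of 0 x] by simp

lemma scaleC_zero_right: "c *\<^sub>C 0 = (0 :: 'a :: complex_inner)"
  using scaleC_add_right[of c 0 "0 :: 'a"] by simp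

lemma scaleC_minus_right: "c *\<^sub>C (- x) = - (c *\<^sub>C (x :: 'a :: complex_inner))"
  using scaleC_add_right[of c "- x" x] by (simp add: scaleC_zero_right eq_neg_iff_add_eq_0)

lemma scaleC_diff_right: "c *\<^sub>C (x - y) = c *\<^sub>C x - c *\<^sub>C (y :: 'a :: complex_inner)"
  using scaleC_add_right[of c x "- y"] by (simp add: scaleC_minus_right)

lemma scaleC_scaleR_commute: "c *\<^sub>C (r *\<^sub>R x) = r *\<^sub>R (c *\<^sub>C (x :: 'a :: complex_inner))"
  by (simp add: scaleR_scaleC scaleC_scaleC mult.commute)

lemma cinner_zero_left: "cinner 0 y = 0" for y :: "'a :: complex_inner"
  using cinner_add_left[of 0 0 y] by simp

lemma cinner_minus_left: "cinner (- x) y = - cinner x y" for y :: "'a :: complex_inner"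
  using cinner_add_left[of "- x" x y] by (simp add: cinner_zero_left eq_neg_iff_add_eq_0)

lemma cinner_diff_left: "cinner (x - y) z = cinner x z - cinner y z"
  for z :: "'a :: complex_inner"
  using cinner_add_left[of x "- y" z] by (simp add: cinner_minus_left)

lemma cinner_scaleR_left: "cinner (r *\<^sub>R x) y = of_real r * cinner x y"
  for y :: "'a :: complex_inner"
  by (simp add: scaleR_scaleC cinner_scaleC_left)

lemma cinner_scaleR_right: "cinner x (r *\<^sub>R y) = of_real r * cinner x y"
  for y :: "'a :: complex_inner"
  by (simp add: scaleR_scaleC cinner_scaleC_right)

lemma cinner_eqI: "x = y" if "\<And>z. cinner x z = cinner y z" for x y :: "'a :: complex_inner"
proof -
  have "cinner (x - y) (x - y) = 0"
    using that by (simp add: cinner_diff_left)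
  then show ?thesis by (simp add: cinner_self)
qed

lemma norm_add_cinner: "(norm (x + y))\<^sup>2 = (norm x)\<^sup>2 + 2 * Re (cinner x y) + (norm y)\<^sup>2"
  for x y :: "'a :: complex_inner"
proof -
  have "Re (cinner (x + y) (x + y))
      = Re (cinner x x) + Re (cinner x y) + Re (cinner y x) + Re (cinner y y)"
    by (simp add: cinner_add_left cinner_add_right)
  moreover have "Re (cinner y x) = Re (cinner x y)"
    using arg_cong[OF cinner_commute[of y x], of Re] by simp
  ultimately show ?thesis by (simp add: cinner_self)
qed

lemma Re_cinner_le: "Re (cinner x y) \<le> norm x * norm y" for x y :: "'a :: complex_inner"
proof -
  have "(norm (x + y))\<^sup>2 \<le> (norm x + norm y)\<^sup>2"
    by (simp add: norm_triangle_ineq power_mono)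
  then show ?thesis by (simp add: norm_add_cinner power2_sum)
qed

lemma norm_scaleC: "norm (c *\<^sub>C x) = cmod c * norm x" for x :: "'a :: complex_inner"
proof -
  have "complex_of_real ((norm (c *\<^sub>C x))\<^sup>2) = complex_of_real ((cmod c * norm x)\<^sup>2)"
    unfolding cinner_self[symmetric] cinner_scaleC_left cinner_scaleC_right
    using complex_norm_square[of c]
    by (simp add: cinner_self power_mult_distrib mult_ac)
  then show ?thesis by (metis of_real_eq_iff mult_nonneg_nonneg norm_ge_zero power2_eq_imp_eq)
qed

lemma cmod_cinner_le: "cmod (cinner x y) \<le> norm x * norm y" for x y :: "'a :: complex_inner"
proof (cases "cinner x y = 0")
  case False
  define u where "u = cnj (sgn (cinner x y))"
  have "cmod u = 1" using False by (simp add: u_def norm_sgn)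
  have "cinner x y = of_real (cmod (cinner x y)) * sgn (cinner x y)"
    using False by (simp add: sgn_eq)
  then have "u * cinner x y = of_real (cmod (cinner x y)) * (u * cnj u)"
    by (metis complex_cnj_cnj mult.left_commute u_def)
  also have "u * cnj u = 1"
    using \<open>cmod u = 1\<close> complex_norm_square[of u] by simp
  finally have "Re (cinner (u *\<^sub>C x) y) = cmod (cinner x y)"
    by (simp add: cinner_scaleC_left)
  then show ?thesis
    using Re_cinner_le[of "u *\<^sub>C x" y] \<open>cmod u = 1\<close> by (simp add: norm_scaleC)
qed simp

text \<open>The Riesz representation theorem, needed for the existence of adjoints.\<close>

lemma riesz_real:
  fixes f :: "'a :: chilbert_space \<Rightarrow> real"
  assumes "bounded_linear f"
  shows "\<exists>z. \<forall>x. f x = Re (cinner x z)"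
proof -
  interpret f: bounded_linear f by fact
  obtain K where K: "\<And>x. norm (f x) \<le> norm x * K" using f.bounded by blast
  define J where "J x = (norm x)\<^sup>2 - 2 * f x" for x
  have lower: "- K\<^sup>2 \<le> J x" for x
  proof -
    have "f x \<le> norm x * K" using K[of x] by (simp add: abs_le_iff)
    moreover have "0 \<le> (norm x - K)\<^sup>2" by simp
    ultimately show ?thesis by (simp add: J_def power2_diff)
  qed
  define m where "m = Inf (range J)"
  have bdd: "bdd_below (range J)" using lower by (auto intro!: bdd_belowI)
  have m_le: "m \<le> J x" for x unfolding m_def by (rule cInf_lower[OF _ bdd]) simp
  have "\<exists>x. J x < m + 1 / real (Suc n)" for n
  proof -
    have "Inf (range J) < m + 1 / real (Suc n)" by (simp add: m_def)
    then show ?thesis using cInf_lessD[of "range J"] by blast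
  qed
  then obtain X where X: "\<And>n. J (X n) < m + 1 / real (Suc n)" by metis
  have mid: "(dist x y)\<^sup>2 \<le> 2 * (J x - m) + 2 * (J y - m)" for x y
  proof -
    have "(norm (x - y))\<^sup>2 + (norm (x + y))\<^sup>2 = 2 * (norm x)\<^sup>2 + 2 * (norm y)\<^sup>2"
      using norm_add_cinner[of x y] norm_add_cinner[of x "- y"] cinner_scaleR_right[of x "-1" y]
      by simp
    moreover have "J ((1/2) *\<^sub>R (x + y)) = (norm (x + y))\<^sup>2 / 4 - f x - f y"
      by (simp add: J_def f.scaleR f.add power_divide add_divide_distrib)
    ultimately show ?thesis
      using m_le[of "(1/2) *\<^sub>R (x + y)"] by (simp add: J_def dist_norm)
  qed
  have "Cauchy X"
  proof (rule metric_CauchyI)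
    fix e :: real assume "e > 0"
    then obtain N where N: "inverse (real (Suc N)) < e\<^sup>2 / 4"
      using reals_Archimedean[of "e\<^sup>2 / 4"] by auto
    have *: "J (X n) - m < e\<^sup>2 / 4" if "n \<ge> N" for n
    proof -
      have "1 / real (Suc n) \<le> inverse (real (Suc N))" using that by (simp add: field_simps)
      then show ?thesis using X[of n] N by linarith
    qed
    have "dist (X i) (X j) < e" if "i \<ge> N" "j \<ge> N" for i j
    proof -
      have "(dist (X i) (X j))\<^sup>2 < e\<^sup>2"
        using mid[of "X i" "X j"] *[OF that(1)] *[OF that(2)] by (simp add: field_simps)
      then show ?thesis using \<open>e > 0\<close> by (simp add: power2_less_imp_less)
    qed
    then show "\<exists>N. \<forall>i\<ge>N. \<forall>j\<ge>N. dist (X i) (X j) < e" by blast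
  qed
  then obtain z where z: "X \<longlonglongrightarrow> z" by (auto simp: Cauchy_convergent_iff convergent_def)
  have "(\<lambda>n. J (X n)) \<longlonglongrightarrow> J z"
    unfolding J_def by (intro tendsto_intros f.tendsto z)
  moreover have "(\<lambda>n. J (X n)) \<longlonglongrightarrow> m"
  proof (rule tendsto_sandwich)
    show "\<forall>\<^sub>F n in sequentially. m \<le> J (X n)"
      using m_le by simp
    show "\<forall>\<^sub>F n in sequentially. J (X n) \<le> m + inverse (real (Suc n))"
      using X by (intro always_eventually allI less_imp_le) (simp add: inverse_eq_divide)
    show "(\<lambda>n. m + inverse (real (Suc n))) \<longlonglongrightarrow> m"
      using tendsto_add[OF tendsto_const LIMSEQ_inverse_real_of_nat, of m] by simp
  qed simp
  ultimately have "J z = m" using LIMSEQ_unique by blast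
  have "f h = Re (cinner h z)" for h
  proof -
    define a where "a = Re (cinner z h) - f h"
    define s where "s = (norm h)\<^sup>2 + 1"
    have "s > 0" unfolding s_def by (simp add: add_nonneg_pos)
    have "J (z + t *\<^sub>R h) = J z + 2 * t * a + t\<^sup>2 * (norm h)\<^sup>2" for t
      by (simp add: J_def norm_add_cinner cinner_scaleR_right f.add f.scaleR a_def
          power_mult_distrib algebra_simps)
    then have nonneg: "0 \<le> 2 * t * a + t\<^sup>2 * (norm h)\<^sup>2" for t
      using m_le[of "z + t *\<^sub>R h"] \<open>J z = m\<close> by simp
    from nonneg[of "- a / s"] have "0 \<le> 2 * (- a / s) * a + (a / s)\<^sup>2 * (norm h)\<^sup>2" by simp
    also have "\<dots> \<le> 2 * (- a / s) * a + (a / s)\<^sup>2 * s"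
      by (intro add_left_mono mult_left_mono) (auto simp: s_def)
    also have "\<dots> = - (a\<^sup>2 / s)" using \<open>s > 0\<close> by (simp add: power2_eq_square field_simps)
    finally have "a = 0" using \<open>s > 0\<close> by (simp add: divide_le_0_iff)
    moreover have "Re (cinner z h) = Re (cinner h z)"
      using arg_cong[OF cinner_commute[of z h], of Re] by simp
    ultimately show ?thesis by (simp add: a_def)
  qed
  then show ?thesis by blast
qed

text \<open>Bounded complex-linear operators on a complex inner product space.\<close>

typedef (overloaded) 'a bop =
  "{A :: 'a :: complex_inner \<Rightarrow> 'a. bounded_linear A \<and> (\<forall>c x. A (c *\<^sub>C x) = c *\<^sub>C A x)}"
  morphisms apply_bop Bop
  by (intro exI[of _ "\<lambda>x. 0"]) (simp add: scaleC_zero_right bounded_linear_zero)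

setup_lifting type_definition_bop

text \<open>
  Operators form a ring under composition. The class \<open>ring_1\<close> is unavailable because
  \<open>0 = 1\<close> on the zero space.
\<close>

instantiation bop :: (complex_inner) "{ring, monoid_mult}"
begin

lift_definition zero_bop :: "'a bop" is "\<lambda>x. 0"
  by (simp add: scaleC_zero_right bounded_linear_zero)

lift_definition one_bop :: "'a bop" is "\<lambda>x. x"
  by (simp add: bounded_linear_ident)

lift_definition plus_bop :: "'a bop \<Rightarrow> 'a bop \<Rightarrow> 'a bop" is "\<lambda>A B x. A x + B x"
  by (simp add: scaleC_add_right bounded_linear_add)

lift_definition uminus_bop :: "'a bop \<Rightarrow> 'a bop" is "\<lambda>A x. - A x"
  by (simp add: scaleC_minus_right bounded_linear_minus)

lift_definition minus_bop :: "'a bop \<Rightarrow> 'a bop \<Rightarrow> 'a bop" is "\<lambda>A B x. A x - B x"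
  by (simp add: scaleC_diff_right bounded_linear_sub)

lift_definition times_bop :: "'a bop \<Rightarrow> 'a bop \<Rightarrow> 'a bop" is "\<lambda>A B x. A (B x)"
  by (simp add: bounded_linear_compose)

instance
  by standard
    (transfer; auto simp: algebra_simps linear_add bounded_linear.linear)+

end

text \<open>Uniqueness and existence are \<open>adj_unique\<close> and \<open>cinner_adj_left\<close> below.\<close>

definition adj :: "'a :: chilbert_space bop \<Rightarrow> 'a bop"
  where "adj A = (THE B. \<forall>x y. cinner (apply_bop B x) y = cinner x (apply_bop A y))"

lemma adj_unique:
  assumes "\<And>x y. cinner (apply_bop B x) y = cinner x (apply_bop A y)"
    and "\<And>x y. cinner (apply_bop C x) y = cinner x (apply_bop A y)"
  shows "B = C"
proof -
  have "apply_bop B x = apply_bop C x" for x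
    by (rule cinner_eqI) (simp add: assms)
  then show ?thesis by (metis apply_bop_inject ext)
qed

lemma adj_exists:
  fixes A :: "'a :: chilbert_space bop"
  shows "\<exists>B. \<forall>x y. cinner (apply_bop B x) y = cinner x (apply_bop A y)"
proof -
  define T where "T = apply_bop A"
  have "bounded_linear T" and TC: "T (c *\<^sub>C x) = c *\<^sub>C T x" for c x
    using apply_bop[of A] by (auto simp: T_def)
  interpret T: bounded_linear T by fact
  obtain K where K: "K > 0" "\<And>x. norm (T x) \<le> norm x * K" using T.pos_bounded by blast
  have "\<exists>z. \<forall>y. Re (cinner (T y) x) = Re (cinner y z)" for x
  proof (rule riesz_real, rule bounded_linear_intro)
    fix y
    have "\<bar>Re (cinner (T y) x)\<bar> \<le> norm (T y) * norm x"
      using abs_Re_le_cmod cmod_cinner_le order_trans by blast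
    also have "\<dots> \<le> norm y * (K * norm x)"
      using mult_right_mono[OF K(2)[of y] norm_ge_zero[of x]] by (simp add: mult.assoc)
    finally show "norm (Re (cinner (T y) x)) \<le> norm y * (K * norm x)" by simp
  qed (simp_all add: T.add T.scaleR cinner_add_left cinner_scaleR_left)
  then obtain S where S: "\<And>x y. Re (cinner (T y) x) = Re (cinner y (S x))" by metis
  have TS: "cinner (T y) x = cinner y (S x)" for x y
  proof (rule complex_eqI)
    show "Im (cinner (T y) x) = Im (cinner y (S x))"
      using S[of "\<i> *\<^sub>C y" x] by (simp add: TC cinner_scaleC_left)
  qed (rule S)
  then have ST: "cinner (S x) y = cinner x (T y)" for x y
    by (metis cinner_commute)
  have "bounded_linear S"
  proof (rule bounded_linear_intro)
    show "S (x + y) = S x + S y" for x y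
      by (rule cinner_eqI) (simp add: ST cinner_add_left)
    show "S (r *\<^sub>R x) = r *\<^sub>R S x" for r x
      by (rule cinner_eqI) (simp add: ST cinner_scaleR_left)
    fix x
    have "(norm (S x))\<^sup>2 = Re (cinner x (T (S x)))"
      using arg_cong[OF cinner_self[of "S x"], of Re] by (simp add: ST)
    also have "\<dots> \<le> norm x * norm (T (S x))" by (rule Re_cinner_le)
    also have "\<dots> \<le> norm x * (norm (S x) * K)" by (intro mult_left_mono K) simp
    finally have "norm (S x) * norm (S x) \<le> norm (S x) * (norm x * K)"
      by (simp add: power2_eq_square mult_ac)
    then show "norm (S x) \<le> norm x * K"
      using K(1) by (cases "S x = 0") simp_all
  qed
  moreover have "S (c *\<^sub>C x) = c *\<^sub>C S x" for c x
    by (rule cinner_eqI) (simp add: ST cinner_scaleC_left)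
  ultimately have "apply_bop (Bop S) = S" by (simp add: Bop_inverse)
  then show ?thesis using ST unfolding T_def by metis
qed

lemma cinner_adj_left: "cinner (apply_bop (adj A) x) y = cinner x (apply_bop A y)"
proof -
  have "\<exists>!B. \<forall>x y. cinner (apply_bop B x) y = cinner x (apply_bop A y)"
    using adj_exists[of A] adj_unique by (metis (no_types, lifting))
  from theI'[OF this] show ?thesis unfolding adj_def by blast
qed

text \<open>Tuples of operators are lists.\<close>

definition spherically_quasinormal :: "'a :: chilbert_space bop list \<Rightarrow> bool"
  where "spherically_quasinormal As \<longleftrightarrow>
    (\<forall>A \<in> set As. A * (\<Sum>B\<leftarrow>As. adj B * B) = (\<Sum>B\<leftarrow>As. adj B * B) * A)"

definition tuple_comp :: "'a :: complex_inner bop list \<Rightarrow> 'a bop list \<Rightarrow> 'a bop list"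
  where "tuple_comp Ts Ss = [T * S. T \<leftarrow> Ts, S \<leftarrow> Ss]"

text \<open>Only positive exponents matter; the value at \<open>0\<close> is the unit of \<open>tuple_comp\<close>.\<close>

fun tuple_power :: "'a :: complex_inner bop list \<Rightarrow> nat \<Rightarrow> 'a bop list"
  where
    "tuple_power Ts 0 = [1]"
  | "tuple_power Ts (Suc 0) = Ts"
  | "tuple_power Ts (Suc (Suc n)) = tuple_comp Ts (tuple_power Ts (Suc n))"

end

theory Submission
  imports Defs
begin

text \<open>
  Let \<open>Q\<close> be the sum of all \<open>T\<^sub>i\<^sup>* T\<^sub>i\<close>. The corresponding sum for \<open>\<^bold>T \<circ> \<^bold>S\<close> is the sum of all
  \<open>S\<^sub>j\<^sup>* Q S\<^sub>j\<close>, so if every \<open>S\<^sub>j\<close> commutes with \<open>Q\<close> it is the sum for \<open>\<^bold>S\<close> times \<open>Q\<close>. Hence the sum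
  for the \<open>n\<close>-th power is \<open>Q ^ n\<close>, and all products of the \<open>T\<^sub>i\<close> commute with it.
\<close>

definition gram :: "'a :: chilbert_space bop list \<Rightarrow> 'a bop"
  where "gram As = (\<Sum>B\<leftarrow>As. adj B * B)"

lemma spherically_quasinormal_gram:
  "spherically_quasinormal As \<longleftrightarrow> (\<forall>A \<in> set As. A * gram As = gram As * A)"
  by (simp add: spherically_quasinormal_def gram_def)

lemma apply_bop_times: "apply_bop (A * B) x = apply_bop A (apply_bop B x)"
  by transfer simp

lemma adj_times: "adj (A * B) = adj B * adj A"
  by (rule adj_unique[of _ "A * B"]) (simp_all add: cinner_adj_left apply_bop_times)

text \<open>Each entry contributes \<open>adj (T * S) * (T * S) = adj S * (adj T * T) * S\<close>,
  and summing over \<open>T\<close> for fixed \<open>S\<close> gives the middle factor. As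
  \<open>tuple_comp\<close> lists \<open>T\<close> outermost, induction on \<open>Ts\<close> splits
  off one block at a time.\<close>

lemma gram_tuple_comp: "gram (tuple_comp Ts Ss) = (\<Sum>S\<leftarrow>Ss. adj S * gram Ts * S)"
proof (induction Ts)
  case Nil
  then show ?case by (simp add: gram_def tuple_comp_def)
next
  case (Cons T Ts)
  have "gram (tuple_comp (T # Ts) Ss) = (\<Sum>S\<leftarrow>Ss. adj (T * S) * (T * S)) + gram (tuple_comp Ts Ss)"
    by (simp add: gram_def tuple_comp_def comp_def)
  also have "\<dots> = (\<Sum>S\<leftarrow>Ss. adj S * gram (T # Ts) * S)"
    unfolding Cons.IH
    by (simp add: gram_def adj_times distrib_left distrib_right mult.assoc sum_list_addf)
  finally show ?case .
qed

lemma gram_tuple_comp_commute: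
  assumes "\<And>S. S \<in> set Ss \<Longrightarrow> S * gram Ts = gram Ts * S"
  shows "gram (tuple_comp Ts Ss) = gram Ss * gram Ts"
proof -
  have "map (\<lambda>S. adj S * gram Ts * S) Ss = map (\<lambda>S. adj S * S * gram Ts) Ss"
    using assms by (simp add: mult.assoc)
  then show ?thesis
    by (simp only: gram_tuple_comp) (simp add: gram_def sum_list_mult_const)
qed

text \<open>Kept general in \<open>C\<close> for two uses: \<open>gram Ts\<close> when the Gram sum
  of a power is computed, and \<open>gram Ts ^ n\<close> in the final conclusion.\<close>

lemma tuple_power_Suc_commute:
  assumes "\<And>T. T \<in> set Ts \<Longrightarrow> T * C = C * T" and "S \<in> set (tuple_power Ts (Suc n))"
  shows "S * C = C * S"
  using assms(2)
proof (induction n arbitrary: S)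
  case 0
  then show ?case using assms(1) by simp
next
  case (Suc n)
  then obtain T R where S: "S = T * R" "T \<in> set Ts" "R \<in> set (tuple_power Ts (Suc n))"
    by (auto simp: tuple_comp_def)
  have "T * R * C = T * C * R" using Suc.IH[OF S(3)] by (simp add: mult.assoc)
  then show ?case using assms(1)[OF S(2)] S(1) by (simp add: mult.assoc)
qed

lemma gram_tuple_power_Suc:
  assumes "spherically_quasinormal Ts"
  shows "gram (tuple_power Ts (Suc n)) = gram Ts ^ Suc n"
proof (induction n)
  case (Suc n)
  have "gram (tuple_power Ts (Suc (Suc n))) = gram (tuple_power Ts (Suc n)) * gram Ts"
    using assms tuple_power_Suc_commute[of Ts "gram Ts"]
    by (auto simp: spherically_quasinormal_gram intro!: gram_tuple_comp_commute)
  \<comment> \<open>The new factor \<open>gram Ts\<close> stands on the right, hence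
    \<open>power_Suc2\<close>.\<close>
  then show ?case by (simp only: Suc.IH power_Suc2[of _ "Suc n"])
qed simp

theorem theorem2p7:
  fixes Ts :: "'a :: chilbert_space bop list" and d :: nat
  assumes "d \<ge> 1" and "length Ts = d" and "spherically_quasinormal Ts"
  shows "\<forall>n::nat. n \<ge> 1 \<longrightarrow> spherically_quasinormal (tuple_power Ts n)"
proof (intro allI impI)
  fix n :: nat assume "n \<ge> 1"
  then obtain m where n: "n = Suc m" by (cases n) auto
  have "T * gram Ts ^ n = gram Ts ^ n * T" if "T \<in> set Ts" for T
    using that assms(3) power_commuting_commutes[of "gram Ts" T n]
    by (simp add: spherically_quasinormal_gram)
  then show "spherically_quasinormal (tuple_power Ts n)"
    using tuple_power_Suc_commute[of Ts "gram Ts ^ n" _ m] gram_tuple_power_Suc[OF assms(3), of m]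
    by (simp add: spherically_quasinormal_gram n)
qed

end
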